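(* Let $m\ge 1$, let $q_1,\dots,q_m$ be positive integers, and let $\mathit{Afirst}\in\{\mathrm{true},\mathrm{false}\}$. Let $n=q_1+\dots+q_m$, and let $w$ be the word of length $n$ consisting of $m$ alternating blocks of equal letters of lengths $q_1,\dots,q_m$, where the first block consists of $A$s if $\mathit{Afirst}$ is true and of $B$s if $\mathit{Afirst}$ is false, i.e. $w=A^{q_1}B^{q_2}A^{q_3}\cdots$ or $w=B^{q_1}A^{q_2}B^{q_3}\cdots$ respectively. Then the algorithm described in the context (the computation of $d$, of the array $(C_{k,\ell})_{1\le k,\ell\le n}$, and of the returned value) has the following properties. (1) It returns the coefficient $h_w$ of $w$ in the Baker--Campbell--Hausdorff series: $$h_w=\frac1d\sum_{k=1}^n \frac{(-1)^{k+1}C_{k,n}}{k}.$$ (2) Apart from the final division by $d$, all its computations are in integer arithmetic with exact divisions: every division $d/\ell!$, $d/(r!\,q_m!)$, $C_{k-1,\ell-j}/j!$, $C_{k-1,\ell-r-j}/(r!\,j!)$ performed in computing the array, and every division $C_{k,n}/k$ ($1\le k\le n$) in the returned expression, yields an integer (so in particular all $C_{k,\ell}$ are integers).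
   Context: Let $\mathbb{Q}\langle\langle A,B\rangle\rangle$ be the ring of formal power series in two non-commuting variables $A,B$ with rational coefficients. The Baker--Campbell--Hausdorff series is $$H=\log(e^Ae^B)=\sum_{k=1}^\infty\frac{(-1)^{k+1}}{k}\big(e^Ae^B-1\big)^k=\sum_{k=1}^\infty\frac{(-1)^{k+1}}{k}\Big(\sum_{i+j>0}\frac{1}{i!\,j!}A^iB^j\Big)^k,$$ and $h_w\in\mathbb{Q}$ denotes the coefficient of the word $w$ in $H$. For $n\ge 1$ define $$d_n=\prod_{p\ \mathrm{prime},\ p<n}p^{\max\{t\ge 0:\ p^t\le s_p(n)\}},$$ where $s_p(n)$ is the sum of the digits of $n$ in base $p$. The algorithm. Input: positive integers $q_1,\dots,q_m$ and a boolean $\mathit{Afirst}$. Set $n=q_1+\dots+q_m$ and $d=n!\,d_n$. Call block $i$ ($1\le i\le m$) an $A$-block if either $\mathit{Afirst}$ is true and $i$ is odd, or $\mathit{Afirst}$ is false and $i$ is even; otherwise it is a $B$-block. Initialize $C_{k,\ell}=0$ for all $1\le k,\ell\le n$. Process $\ell=1,2,\dots,n$ in increasing order. For each $\ell$ let $(i,r)$ be the unique pair with $1\le i\le m$, $1\le r\le q_i$ and $\ell=r+q_{i+1}+\dots+q_m$ (this amounts to looping over $i=m,m-1,\dots,1$ and, within it, over $r=1,\dots,q_i$). Then: - Set $C_{1,\ell}=d/\ell!$ if $i=m$; set $C_{1,\ell}=d/(r!\,q_m!)$ if $i=m-1$ and block $i$ is an $A$-block; set $C_{1,\ell}=0$ in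 all other cases. - For $k=2,\dots,\ell-1$ set $$C_{k,\ell}=\sum_{\substack{1\le j\le r\\ j<\ell}}\frac{C_{k-1,\ell-j}}{j!}\;+\;f_i\sum_{\substack{1\le j\le q_{i+1}\\ r+j<\ell}}\frac{C_{k-1,\ell-r-j}}{r!\,j!},$$ where $f_i=1$ if $i\le m-1$ and block $i$ is an $A$-block, and $f_i=0$ otherwise (in which case the second sum is omitted and none of its divisions are performed). Terms in which the array entry $C_{k-1,\ell-j}$ or $C_{k-1,\ell-r-j}$ is zero are skipped. - Finally set $C_{\ell,\ell}=d$. After all $\ell$ have been processed, return $\big(\sum_{k=1}^n(-1)^{k+1}C_{k,n}/k\big)/d$. *)

theory Defs
  imports
    Complex_Main
    "HOL-Library.Groups_Big_Fun"
    "HOL-Computational_Algebra.Primes"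
begin

section \<open>The ring of formal power series in two non-commuting variables\<close>

datatype letter = LA | LB

typedef ncps = "UNIV :: (letter list \<Rightarrow> rat) set"
  morphisms nc_coeff Abs_ncps ..

setup_lifting type_definition_ncps

lemma ncps_eqI: "(\<And>w. nc_coeff X w = nc_coeff Y w) \<Longrightarrow> X = Y"
  by (simp add: nc_coeff_inject[symmetric] fun_eq_iff)

lemma finite_splits: "finite {(u, v). u @ v = (w :: 'a list)}"
proof (rule finite_subset)
  show "{(u, v). u @ v = w} \<subseteq> (\<lambda>i. (take i w, drop i w)) ` {..length w}"
  proof clarify
    fix u v :: "'a list"
    show "(u, v) \<in> (\<lambda>i. (take i (u @ v), drop i (u @ v))) ` {..length (u @ v)}"
      by (rule image_eqI[of _ _ "length u"]) auto
  qed
qed simp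

instantiation ncps :: ring_1
begin

lift_definition zero_ncps :: ncps is "\<lambda>_. 0" .

lift_definition one_ncps :: ncps is "\<lambda>w. if w = [] then 1 else 0" .

lift_definition plus_ncps :: "ncps \<Rightarrow> ncps \<Rightarrow> ncps" is "\<lambda>f g w. f w + g w" .

lift_definition minus_ncps :: "ncps \<Rightarrow> ncps \<Rightarrow> ncps" is "\<lambda>f g w. f w - g w" .

lift_definition uminus_ncps :: "ncps \<Rightarrow> ncps" is "\<lambda>f w. - f w" .

lift_definition times_ncps :: "ncps \<Rightarrow> ncps \<Rightarrow> ncps"
  is "\<lambda>f g w. \<Sum>(u, v) \<in> {(u, v). u @ v = w}. f u * g v" .

instance
proof
  fix X Y Z :: ncps
  show "X * Y * Z = X * (Y * Z)"
  proof (transfer, rule ext)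
    fix f g h :: "letter list \<Rightarrow> rat" and w :: "letter list"
    let ?S = "\<lambda>w :: letter list. {(u, v). u @ v = w}"
    have "(\<Sum>(x, c) \<in> ?S w. (\<Sum>(a, b) \<in> ?S x. f a * g b) * h c)
        = (\<Sum>p \<in> ?S w. \<Sum>s \<in> ?S (fst p). f (fst s) * g (snd s) * h (snd p))"
      by (simp add: case_prod_unfold sum_distrib_right)
    also have "\<dots> = (\<Sum>(p, s) \<in> Sigma (?S w) (\<lambda>p. ?S (fst p)).
                    f (fst s) * g (snd s) * h (snd p))"
      by (intro sum.Sigma) (auto simp: finite_splits)
    also have "\<dots> = (\<Sum>(p, s) \<in> Sigma (?S w) (\<lambda>p. ?S (snd p)).
                    f (fst p) * (g (fst s) * h (snd s)))"
      by (rule sum.reindex_bij_witness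
          [of _ "\<lambda>((a, x), (b, c)). ((a @ b, c), (a, b))"
                "\<lambda>((x, c), (a, b)). ((a, b @ c), (b, c))"])
         (auto simp: mult.assoc)
    also have "\<dots> = (\<Sum>p \<in> ?S w. \<Sum>s \<in> ?S (snd p). f (fst p) * (g (fst s) * h (snd s)))"
      by (intro sum.Sigma[symmetric]) (auto simp: finite_splits)
    also have "\<dots> = (\<Sum>(a, x) \<in> ?S w. f a * (\<Sum>(b, c) \<in> ?S x. g b * h c))"
      by (simp add: case_prod_unfold sum_distrib_left)
    finally show "(\<Sum>(x, c) \<in> ?S w. (\<Sum>(a, b) \<in> ?S x. f a * g b) * h c)
        = (\<Sum>(a, x) \<in> ?S w. f a * (\<Sum>(b, c) \<in> ?S x. g b * h c))" .
  qed
  show "1 * X = X"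
  proof (transfer, rule ext)
    fix f :: "letter list \<Rightarrow> rat" and w :: "letter list"
    have "(\<Sum>(u, v) \<in> {(u, v). u @ v = w}. (if u = [] then 1 else 0) * f v)
        = (\<Sum>(u, v) \<in> {([] :: letter list, w)}. (if u = [] then 1 else 0) * f v)"
      by (rule sum.mono_neutral_right) (auto simp: finite_splits split: if_splits)
    then show "(\<Sum>(u, v) \<in> {(u, v). u @ v = w}. (if u = [] then 1 else 0) * f v) = f w"
      by simp
  qed
  show "X * 1 = X"
  proof (transfer, rule ext)
    fix f :: "letter list \<Rightarrow> rat" and w :: "letter list"
    have "(\<Sum>(u, v) \<in> {(u, v). u @ v = w}. f u * (if v = [] then 1 else 0))
        = (\<Sum>(u, v) \<in> {(w, [] :: letter list)}. f u * (if v = [] then 1 else 0))"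
      by (rule sum.mono_neutral_right) (auto simp: finite_splits split: if_splits)
    then show "(\<Sum>(u, v) \<in> {(u, v). u @ v = w}. f u * (if v = [] then 1 else 0)) = f w"
      by simp
  qed
  show "(X + Y) * Z = X * Z + Y * Z"
    by transfer (simp add: case_prod_unfold distrib_right sum.distrib)
  show "X * (Y + Z) = X * Y + X * Z"
    by transfer (simp add: case_prod_unfold distrib_left sum.distrib)
  show "X + Y + Z = X + (Y + Z)" by transfer (simp add: add.assoc)
  show "X + Y = Y + X" by transfer (simp add: add.commute)
  show "0 + X = X" by transfer simp
  show "- X + X = 0" by transfer simp
  show "X - Y = X + - Y" by transfer simp
  show "(0 :: ncps) \<noteq> 1" by transfer (simp add: fun_eq_iff)
qed

end

lift_definition nc_var :: "letter \<Rightarrow> ncps" is "\<lambda>x w. if w = [x] then 1 else 0" .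

lift_definition nc_scale :: "rat \<Rightarrow> ncps \<Rightarrow> ncps" is "\<lambda>c f w. c * f w" .

text \<open>
  Infinite sums are formed coefficientwise. They are used only for families in which every word
  has a non-zero coefficient in just finitely many members
  (see \<open>nc_exp_locally_finite\<close> and \<open>nc_log_locally_finite\<close> below); otherwise
  \<^const>\<open>Sum_any\<close> would yield the default value 0.
\<close>

lift_definition nc_suminf :: "(nat \<Rightarrow> ncps) \<Rightarrow> ncps" is "\<lambda>F w. Sum_any (\<lambda>k. F k w)" .

text \<open>The exponential is meaningful for series with constant term 0,
  the logarithm for series with constant term 1.\<close>

definition nc_exp :: "ncps \<Rightarrow> ncps" where
  "nc_exp X = nc_suminf (\<lambda>k. nc_scale (1 / fact k) (X ^ k))"

definition nc_log :: "ncps \<Rightarrow> ncps" where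
  "nc_log Y = nc_suminf (\<lambda>k. if k = 0 then 0
                             else nc_scale ((-1) ^ (k + 1) / of_nat k) ((Y - 1) ^ k))"

definition bch_series :: ncps where
  "bch_series = nc_log (nc_exp (nc_var LA) * nc_exp (nc_var LB))"

lemma nc_coeff_power_eq_0:
  assumes "nc_coeff X [] = 0" and "length w < k"
  shows "nc_coeff (X ^ k) w = 0"
  using assms(2)
proof (induction k arbitrary: w)
  case (Suc k)
  have "nc_coeff X u * nc_coeff (X ^ k) v = 0" if "u @ v = w" for u v
  proof (cases "u = []")
    case False
    then have "length v < k" using that Suc.prems by (cases u) auto
    then show ?thesis using Suc.IH by simp
  qed (simp add: assms(1))
  then show ?case
    by (auto simp: times_ncps.rep_eq intro!: sum.neutral)
qed simp

lemma nc_exp_locally_finite: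
  assumes "nc_coeff X [] = 0"
  shows "finite {k. nc_coeff (nc_scale (1 / fact k) (X ^ k)) w \<noteq> 0}"
proof (rule finite_subset)
  show "{k. nc_coeff (nc_scale (1 / fact k) (X ^ k)) w \<noteq> 0} \<subseteq> {..length w}"
    using nc_coeff_power_eq_0[OF assms, of w] by (force simp: nc_scale.rep_eq not_less[symmetric])
qed simp

lemma nc_log_locally_finite:
  assumes "nc_coeff Y [] = 1"
  shows "finite {k. nc_coeff (if k = 0 then 0
                    else nc_scale ((-1) ^ (k + 1) / of_nat k) ((Y - 1) ^ k)) w \<noteq> 0}"
proof (rule finite_subset)
  have "nc_coeff (Y - 1) [] = 0"
    using assms by (simp add: minus_ncps.rep_eq one_ncps.rep_eq)
  from nc_coeff_power_eq_0[OF this, of w]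
  show "{k. nc_coeff (if k = 0 then 0
            else nc_scale ((-1) ^ (k + 1) / of_nat k) ((Y - 1) ^ k)) w \<noteq> 0} \<subseteq> {..length w}"
    by (force simp: nc_scale.rep_eq zero_ncps.rep_eq not_less[symmetric])
qed simp

lemma nc_coeff_exp_Nil:
  assumes "nc_coeff X [] = 0"
  shows "nc_coeff (nc_exp X) [] = 1"
proof -
  have "nc_coeff (nc_scale (1 / fact k) (X ^ k)) [] = (if k = 0 then 1 else 0)" for k
    using nc_coeff_power_eq_0[OF assms, of "[]" k]
    by (auto simp: nc_scale.rep_eq one_ncps.rep_eq)
  then show ?thesis
    by (simp add: nc_exp_def nc_suminf.rep_eq Sum_any.expand_set)
qed

lemma nc_coeff_exp_times_exp_Nil:
  "nc_coeff (nc_exp (nc_var LA) * nc_exp (nc_var LB)) [] = 1"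
proof -
  have "{(u, v). u @ v = ([] :: letter list)} = {([], [])}" by auto
  then show ?thesis
    by (simp add: times_ncps.rep_eq nc_coeff_exp_Nil nc_var.rep_eq)
qed


section \<open>The common denominator\<close>

text \<open>For \<open>p \<ge> 2\<close> all base-\<open>p\<close> digits of \<open>n\<close> at positions beyond \<open>n\<close> vanish.\<close>

definition digit_sum :: "nat \<Rightarrow> nat \<Rightarrow> nat" where
  "digit_sum p n = (\<Sum>i\<le>n. n div p ^ i mod p)"

definition d_seq :: "nat \<Rightarrow> nat" where
  "d_seq n = (\<Prod>p | prime p \<and> p < n. p ^ Max {t. p ^ t \<le> digit_sum p n})"


section \<open>The algorithm\<close>

text \<open>
  The input \<open>q\<^sub>1, \<dots>, q\<^sub>m\<close> is a function \<open>q\<close> of which only the values on \<open>{1..m}\<close> matter.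
\<close>

definition A_block :: "bool \<Rightarrow> nat \<Rightarrow> bool" where
  "A_block Afirst i \<longleftrightarrow> (Afirst \<and> odd i) \<or> (\<not> Afirst \<and> even i)"

definition block_word :: "nat \<Rightarrow> (nat \<Rightarrow> nat) \<Rightarrow> bool \<Rightarrow> letter list" where
  "block_word m q Afirst =
     concat (map (\<lambda>i. replicate (q i) (if A_block Afirst i then LA else LB)) [1..<Suc m])"

definition position :: "nat \<Rightarrow> (nat \<Rightarrow> nat) \<Rightarrow> nat \<Rightarrow> nat \<Rightarrow> nat" where
  "position m q i r = r + (\<Sum>t = i + 1..m. q t)"

text \<open>One pass of the main loop, for \<open>\<ell> = position m q i r\<close>; the entry \<open>C\<^sub>k\<^sub>,\<^sub>\<ell>\<close> is \<open>C (k, \<ell>)\<close>.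
  All arithmetic is carried out in the rationals, so that exactness of the divisions is
  a property to be proved.\<close>

definition bch_first :: "nat \<Rightarrow> nat \<Rightarrow> (nat \<Rightarrow> nat) \<Rightarrow> bool \<Rightarrow> nat \<Rightarrow> nat \<Rightarrow> rat" where
  "bch_first d m q Afirst i r =
     (if i = m then of_nat d / fact (position m q i r)
      else if i + 1 = m \<and> A_block Afirst i then of_nat d / (fact r * fact (q m))
      else 0)"

definition bch_entry ::
  "nat \<Rightarrow> (nat \<Rightarrow> nat) \<Rightarrow> bool \<Rightarrow> nat \<Rightarrow> nat \<Rightarrow> (nat \<times> nat \<Rightarrow> rat) \<Rightarrow> nat \<Rightarrow> rat" where
  "bch_entry m q Afirst i r C k =
     (let l = position m q i r in
        (\<Sum>j | 1 \<le> j \<and> j \<le> r \<and> j < l \<and> C (k - 1, l - j) \<noteq> 0.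
           C (k - 1, l - j) / fact j)
      + (if i < m \<and> A_block Afirst i
         then \<Sum>j | 1 \<le> j \<and> j \<le> q (i + 1) \<and> r + j < l \<and> C (k - 1, l - r - j) \<noteq> 0.
                C (k - 1, l - r - j) / (fact r * fact j)
         else 0))"

definition bch_step ::
  "nat \<Rightarrow> nat \<Rightarrow> (nat \<Rightarrow> nat) \<Rightarrow> bool \<Rightarrow> nat \<times> nat \<Rightarrow> (nat \<times> nat \<Rightarrow> rat) \<Rightarrow> (nat \<times> nat \<Rightarrow> rat)" where
  "bch_step d m q Afirst = (\<lambda>(i, r) C0.
     let l = position m q i r;
         C1 = C0((1, l) := bch_first d m q Afirst i r);
         C2 = fold (\<lambda>k C. C((k, l) := bch_entry m q Afirst i r C k)) [2..<l] C1
     in C2((l, l) := of_nat d))"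

text \<open>The loop over \<open>i = m, \<dots>, 1\<close> and, within it, \<open>r = 1, \<dots>, q\<^sub>i\<close>.\<close>

definition loop_pairs :: "nat \<Rightarrow> (nat \<Rightarrow> nat) \<Rightarrow> (nat \<times> nat) list" where
  "loop_pairs m q = concat (map (\<lambda>i. map (\<lambda>r. (i, r)) [1..<Suc (q i)]) (rev [1..<Suc m]))"

lemma loop_pairs_positions:
  "map (\<lambda>(i, r). position m q i r) (loop_pairs m q) = [1..<Suc (\<Sum>i = 1..m. q i)]"
proof -
  have "map (\<lambda>(i, r). position m q i r)
          (concat (map (\<lambda>i. map (\<lambda>r. (i, r)) [1..<Suc (q i)]) (rev [Suc a..<Suc m])))
        = [1..<Suc (\<Sum>i = Suc a..m. q i)]" if "a \<le> m" for a
    using that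
  proof (induction rule: inc_induct)
    case (step a)
    let ?s = "\<Sum>i = Suc (Suc a)..m. q i"
    have sum: "(\<Sum>i = Suc a..m. q i) = ?s + q (Suc a)"
      using step.hyps by (simp add: sum.atLeast_Suc_atMost)
    have "map (\<lambda>r. r + ?s) [1..<Suc (q (Suc a))] = [Suc ?s..<Suc (?s + q (Suc a))]"
      by (rule nth_equalityI) (auto simp del: upt_Suc)
    moreover have "[Suc a..<Suc m] = Suc a # [Suc (Suc a)..<Suc m]"
      using step.hyps by (simp add: upt_conv_Cons del: upt_Suc)
    moreover have "[1..<Suc ?s] @ [Suc ?s..<Suc (?s + q (Suc a))] = [1..<Suc (?s + q (Suc a))]"
      using upt_add_eq_append[of 1 "Suc ?s" "q (Suc a)"] by (simp del: upt_Suc)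
    ultimately show ?case
      using step.IH by (simp add: sum position_def comp_def del: upt_Suc)
  qed simp
  from this[of 0] show ?thesis by (simp add: loop_pairs_def del: upt_Suc)
qed

definition bch_array :: "nat \<Rightarrow> (nat \<Rightarrow> nat) \<Rightarrow> bool \<Rightarrow> nat \<times> nat \<Rightarrow> rat" where
  "bch_array m q Afirst =
     (let n = \<Sum>i = 1..m. q i;
          d = fact n * d_seq n
      in fold (bch_step d m q Afirst) (loop_pairs m q) (\<lambda>_. 0))"

definition bch_algorithm :: "nat \<Rightarrow> (nat \<Rightarrow> nat) \<Rightarrow> bool \<Rightarrow> rat" where
  "bch_algorithm m q Afirst =
     (let n = \<Sum>i = 1..m. q i;
          d = fact n * d_seq n;
          C = bch_array m q Afirst
      in (\<Sum>k = 1..n. (-1) ^ (k + 1) * C (k, n) / of_nat k) / of_nat d)"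

end

theory Submission
  imports Defs
begin

text \<open>
  Write \<open>Y = e\<^sup>A e\<^sup>B - 1\<close> (\<open>bch_base\<close> below), so that the Baker--Campbell--Hausdorff series is
  \<open>\<Sum>k\<ge>1. (-1)\<^sup>k\<^sup>+\<^sup>1 Y\<^sup>k / k\<close>.

  \<^bold>\<open>Correctness.\<close> The entry \<open>C (k, l)\<close> is \<open>d\<close> times the coefficient in \<open>Y\<^sup>k\<close> of the suffix of
  length \<open>l\<close> of the input word (\<open>bch_array_eq\<close>). Indeed, this coefficient is the sum, over all ways of
  splitting off a non-empty prefix, of the coefficient of the prefix in \<open>Y\<close> times that of the
  remaining suffix in \<open>Y\<^sup>k\<^sup>-\<^sup>1\<close>. Only prefixes of the form \<open>A\<^sup>a B\<^sup>b\<close> contribute, and in a word in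
  blocks these are the pieces of the first block and, if that is an \<open>A\<close>-block, the whole of it
  together with a piece of the second (\<open>nc_coeff_base_take_blocks\<close>). These are exactly the two sums in
  the algorithm. The theorem then follows from \<open>nc_coeff_bch_series\<close>.

  \<^bold>\<open>Exactness within the array.\<close> A coefficient of \<open>Y\<^sup>k\<close> at a word of length \<open>l\<close> is a sum of inverses
  of products of factorials whose arguments add up to \<open>l\<close>. Multinomial coefficients being integers,
  \<open>n!\<close> alone clears these denominators together with those of the division being performed
  (\<open>fact_times_nc_coeff_base_power_Ints\<close>, \<open>fact_mult_div_fact_Ints\<close>).

  \<^bold>\<open>Divisibility of \<open>C (k, n)\<close> by \<open>k\<close>.\<close> This is checked one prime \<open>p\<close> at a time. Let \<open>s\<close> be the base-\<open>p\<close>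
  digit sum. By Legendre's formula \<open>(p - 1) v\<^sub>p(a!) = a - s(a)\<close>, a product of factorials whose
  arguments add up to \<open>n\<close>, with at least \<open>k\<close> of them positive, has valuation at most
  \<open>(n - k) / (p - 1)\<close>. Hence the integer \<open>N = n! c\<close>, where \<open>c\<close> is the coefficient of the word in
  \<open>Y\<^sup>k\<close>, satisfies \<open>(p - 1) v\<^sub>p(N) \<ge> k - s(n)\<close>. If \<open>p\<^sup>T\<close> is the largest power of \<open>p\<close> that is at most
  \<open>s(n)\<close>, then with \<open>u = v\<^sub>p(N)\<close>
  \<open>k \<le> s(n) + (p - 1) u < p\<^sup>T\<^sup>+\<^sup>1 + (p - 1) u \<le> p\<^sup>T\<^sup>+\<^sup>1\<^sup>+\<^sup>u\<close>,
  the last step by Bernoulli's inequality. So \<open>v\<^sub>p(k) \<le> T + u\<close>, and \<open>p\<^sup>T\<close> is precisely what \<open>d_seq n\<close>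
  supplies (\<open>dvd_mult_d_seq\<close>).
\<close>

section \<open>Coefficients of the exponential product\<close>

lemma nc_coeff_times:
  "nc_coeff (X * Z) w = (\<Sum>s\<le>length w. nc_coeff X (take s w) * nc_coeff Z (drop s w))"
proof -
  have "nc_coeff (X * Z) w = (\<Sum>(u, v) \<in> {(u, v). u @ v = w}. nc_coeff X u * nc_coeff Z v)"
    by (simp add: times_ncps.rep_eq)
  also have "\<dots> = (\<Sum>s\<le>length w. nc_coeff X (take s w) * nc_coeff Z (drop s w))"
    by (rule sum.reindex_bij_witness
          [of _ "\<lambda>s. (take s w, drop s w)" "\<lambda>(u, v). length u"]) auto
  finally show ?thesis .
qed

lemma nc_coeff_var_power: "nc_coeff (nc_var x ^ k) w = (if w = replicate k x then 1 else 0)"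
proof (induction k arbitrary: w)
  case 0
  then show ?case by (simp add: one_ncps.rep_eq)
next
  case (Suc k)
  have indicator_mult: "(if P then 1 else 0) * (if Q then 1 else 0) = (if R then 1 else (0 :: rat))"
    if "(P \<and> Q) = R" for P Q R
    using that by auto
  have "nc_coeff (nc_var x ^ Suc k) w =
      (\<Sum>s\<le>length w. if s = 1 \<and> w = replicate (Suc k) x then 1 else 0)"
    unfolding power_Suc nc_coeff_times
  proof (rule sum.cong)
    fix s assume "s \<in> {..length w}"
    have "take s w = [x] \<and> drop s w = replicate k x \<longleftrightarrow> s = 1 \<and> w = replicate (Suc k) x"
    proof
      assume *: "take s w = [x] \<and> drop s w = replicate k x"
      then have "w = replicate (Suc k) x"
        using append_take_drop_id[of s w] by simp
      moreover have "s = 1"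
        using arg_cong[OF conjunct1[OF *], of length] \<open>s \<in> _\<close> by simp
      ultimately show "s = 1 \<and> w = replicate (Suc k) x" by simp
    qed simp
    then have "(if take s w = [x] then 1 else 0) * (if drop s w = replicate k x then 1 else 0) =
        (if s = 1 \<and> w = replicate (Suc k) x then 1 else (0 :: rat))"
      by (rule indicator_mult)
    then show "nc_coeff (nc_var x) (take s w) * nc_coeff (nc_var x ^ k) (drop s w) =
        (if s = 1 \<and> w = replicate (Suc k) x then 1 else 0)"
      by (simp only: Suc.IH nc_var.rep_eq)
  qed simp
  also have "\<dots> = (if w = replicate (Suc k) x then 1 else 0)"
    by (cases "w = replicate (Suc k) x") auto
  finally show ?case .
qed

lemma nc_coeff_exp_var:
  "nc_coeff (nc_exp (nc_var x)) w = (if w = replicate (length w) x then 1 / fact (length w) else 0)"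
proof -
  have "nc_coeff (nc_exp (nc_var x)) w =
      (\<Sum>k\<in>{length w}. nc_coeff (nc_scale (1 / fact k) (nc_var x ^ k)) w)"
    unfolding nc_exp_def nc_suminf.rep_eq
    by (rule Sum_any.expand_superset)
       (auto simp: nc_scale.rep_eq nc_coeff_var_power split: if_splits)
  then show ?thesis by (simp add: nc_scale.rep_eq nc_coeff_var_power)
qed

definition expAB :: ncps where
  "expAB = nc_exp (nc_var LA) * nc_exp (nc_var LB)"

lemma nc_coeff_expAB_A_B:
  "nc_coeff expAB (replicate a LA @ replicate b LB) = 1 / (fact a * fact b)"
proof -
  let ?w = "replicate a LA @ replicate b LB"
  have "nc_coeff expAB ?w = (\<Sum>s\<le>a + b. if s = a then 1 / (fact a * fact b) else 0)"
    unfolding expAB_def nc_coeff_times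
  proof (rule sum.cong)
    fix s assume s: "s \<in> {..a + b}"
    show "nc_coeff (nc_exp (nc_var LA)) (take s ?w) * nc_coeff (nc_exp (nc_var LB)) (drop s ?w) =
        (if s = a then 1 / (fact a * fact b) else 0)"
    proof (cases s a rule: linorder_cases)
      case less
      then have "LA \<in> set (drop s ?w)" by simp
      then have "drop s ?w \<noteq> replicate (length (drop s ?w)) LB"
        by (metis in_set_replicate letter.distinct(1))
      with less show ?thesis by (simp add: nc_coeff_exp_var del: drop_append drop_replicate length_drop)
    next
      case greater
      with s have "LB \<in> set (take s ?w)" by simp
      then have "take s ?w \<noteq> replicate (length (take s ?w)) LA"
        by (metis in_set_replicate letter.distinct(1))
      with greater show ?thesis by (simp add: nc_coeff_exp_var del: take_append take_replicate length_take)
    qed (simp add: nc_coeff_exp_var)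
  qed simp
  then show ?thesis by simp
qed

lemma nc_coeff_expAB_eq_0:
  assumes "\<And>a b. w \<noteq> replicate a LA @ replicate b LB"
  shows "nc_coeff expAB w = 0"
proof -
  have "nc_coeff (nc_exp (nc_var LA)) (take s w) * nc_coeff (nc_exp (nc_var LB)) (drop s w) = 0" for s
    using assms append_take_drop_id[of s w] by (metis mult_eq_0_iff nc_coeff_exp_var)
  then show ?thesis unfolding expAB_def nc_coeff_times by (intro sum.neutral) blast
qed

text \<open>
  Together with \<open>nc_coeff_expAB_A_B\<close> this evaluates \<open>e\<^sup>A e\<^sup>B\<close> on every word that
  arises below: a word is either \<open>A\<^sup>a B\<^sup>b\<close> or has a \<open>B\<close> immediately followed by an \<open>A\<close>.
\<close>
lemma nc_coeff_expAB_BA: "nc_coeff expAB (u @ LB # LA # v) = 0"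
proof (rule nc_coeff_expAB_eq_0)
  fix a b
  show "u @ LB # LA # v \<noteq> replicate a LA @ replicate b LB"
  proof
    assume eq: "u @ LB # LA # v = replicate a LA @ replicate b LB"
    have len: "length u + 2 + length v = a + b"
      using arg_cong[OF eq, of length] by simp
    have "(replicate a LA @ replicate b LB) ! length u = LB"
      unfolding eq[symmetric] by simp
    then have "a \<le> length u"
      by (rule contrapos_pp) (simp add: nth_append)
    moreover have "(replicate a LA @ replicate b LB) ! Suc (length u) = LA"
      unfolding eq[symmetric] by (simp add: nth_append)
    ultimately show False using len by (simp add: nth_append)
  qed
qed

section \<open>The series \<open>e\<^sup>A e\<^sup>B - 1\<close> on words in blocks\<close>

definition bch_base :: ncps where
  "bch_base = expAB - 1"

lemma nc_coeff_bch_base: "nc_coeff bch_base w = (if w = [] then 0 else nc_coeff expAB w)"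
  using nc_coeff_exp_times_exp_Nil
  by (simp add: bch_base_def expAB_def minus_ncps.rep_eq one_ncps.rep_eq)

lemma nc_coeff_bch_series:
  "nc_coeff bch_series w =
     (\<Sum>k = 1..length w. (-1) ^ (k + 1) * nc_coeff (bch_base ^ k) w / of_nat k)"
proof -
  have zero: "nc_coeff (bch_base ^ k) w = 0" if "length w < k" for k
    using that by (intro nc_coeff_power_eq_0) (simp_all add: nc_coeff_bch_base)
  have "nc_coeff bch_series w =
      (\<Sum>k = 1..length w. nc_coeff (if k = 0 then 0
          else nc_scale ((-1) ^ (k + 1) / of_nat k) (bch_base ^ k)) w)"
    unfolding bch_series_def nc_log_def nc_suminf.rep_eq expAB_def[symmetric] bch_base_def[symmetric]
    by (rule Sum_any.expand_superset)
       (use zero in \<open>auto simp: nc_scale.rep_eq zero_ncps.rep_eq not_less[symmetric] Suc_le_eq\<close>)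
  also have "\<dots> = (\<Sum>k = 1..length w. (-1) ^ (k + 1) * nc_coeff (bch_base ^ k) w / of_nat k)"
    by (rule sum.cong) (auto simp: nc_scale.rep_eq)
  finally show ?thesis .
qed

lemma nc_coeff_base_replicate:
  assumes "0 < s"
  shows "nc_coeff bch_base (replicate s x) = 1 / fact s"
  using nc_coeff_expAB_A_B[of s 0] nc_coeff_expAB_A_B[of 0 s] assms
  by (cases x) (simp_all add: nc_coeff_bch_base)

lemma nc_coeff_base_B_block:
  assumes "0 < r" "r < s" "s \<le> r + length T" "hd T = LA"
  shows "nc_coeff bch_base (take s (replicate r LB @ T)) = 0"
proof -
  obtain T' where T: "T = LA # T'" using assms by (cases T) auto
  obtain r' where r: "r = Suc r'" using assms by (cases r) auto
  obtain s' where s: "s = r + Suc s'" using assms(2) less_imp_Suc_add by auto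
  have "take s (replicate r LB @ T) = replicate r' LB @ LB # LA # take s' T'"
    by (simp add: s T) (simp add: r replicate_append_same flip: replicate_app_Cons_same)
  then show ?thesis by (simp add: nc_coeff_bch_base nc_coeff_expAB_BA)
qed

lemma nc_coeff_base_A_B_blocks:
  assumes "0 < j" "0 < r"
  shows "nc_coeff bch_base (replicate r LA @ replicate j LB) = 1 / (fact r * fact j)"
  using assms by (simp add: nc_coeff_bch_base nc_coeff_expAB_A_B)

lemma nc_coeff_base_A_B_A_blocks:
  assumes "0 < b" "r + b < s" "s \<le> r + b + length T" "hd T = LA"
  shows "nc_coeff bch_base (take s (replicate r LA @ replicate b LB @ T)) = 0"
proof -
  obtain T' where T: "T = LA # T'" using assms by (cases T) auto
  obtain b' where b: "b = Suc b'" using assms by (cases b) auto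
  obtain s' where s: "s = r + b + Suc s'" using assms(2) less_imp_Suc_add by auto
  have "take s (replicate r LA @ replicate b LB @ T) = (replicate r LA @ replicate b' LB) @ LB # LA # take s' T'"
    by (simp add: s T) (simp add: b replicate_append_same flip: replicate_app_Cons_same)
  then show ?thesis by (simp only: nc_coeff_bch_base nc_coeff_expAB_BA) simp
qed

section \<open>Powers of \<open>e\<^sup>A e\<^sup>B - 1\<close>\<close>

text \<open>
  All arithmetic information used about \<open>e\<^sup>A e\<^sup>B - 1\<close>; both denominator estimates below start
  from it.
\<close>
lemma nc_coeff_bch_base_cases:
  obtains "nc_coeff bch_base w = 0"
  | a b where "0 < a + b" "length w = a + b" "nc_coeff bch_base w = 1 / (fact a * fact b)"
proof (cases "\<exists>a b. w = replicate a LA @ replicate b LB")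
  case True
  then obtain a b where w: "w = replicate a LA @ replicate b LB" by blast
  show ?thesis
  proof (cases "w = []")
    case False
    then have "0 < a + b" using w by auto
    then show ?thesis
      using that(2)[of a b] w False by (simp add: nc_coeff_bch_base nc_coeff_expAB_A_B)
  qed (use that(1) in \<open>simp add: nc_coeff_bch_base\<close>)
next
  case False
  then show ?thesis using that(1) nc_coeff_expAB_eq_0[of w] by (simp add: nc_coeff_bch_base)
qed

lemma nc_coeff_base_power_eq_0: "length w < k \<Longrightarrow> nc_coeff (bch_base ^ k) w = 0"
  by (intro nc_coeff_power_eq_0) (simp_all add: nc_coeff_bch_base)

lemma nc_coeff_base_power_Suc:
  assumes "0 < k"
  shows "nc_coeff (bch_base ^ Suc k) w =
    (\<Sum>s = 1..<length w. nc_coeff bch_base (take s w) * nc_coeff (bch_base ^ k) (drop s w))"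
  unfolding power_Suc nc_coeff_times
proof (rule sum.mono_neutral_right)
  show "\<forall>s\<in>{..length w} - {1..<length w}.
      nc_coeff bch_base (take s w) * nc_coeff (bch_base ^ k) (drop s w) = 0"
  proof
    fix s assume "s \<in> {..length w} - {1..<length w}"
    then have "s = 0 \<or> s = length w" by auto
    then show "nc_coeff bch_base (take s w) * nc_coeff (bch_base ^ k) (drop s w) = 0"
      using assms nc_coeff_base_power_eq_0[of "[]" k] by (auto simp: nc_coeff_bch_base)
  qed
qed auto

text \<open>
  The only factorization into \<open>length w\<close> non-empty words is the one into single letters. This is
  why the algorithm may put \<open>C (l, l) = d\<close>.
\<close>
lemma nc_coeff_base_power_length: "nc_coeff (bch_base ^ length w) w = 1"
proof (induction w)
  case Nil
  then show ?case by (simp add: one_ncps.rep_eq)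
next
  case (Cons x w)
  have power: "bch_base ^ length (x # w) = bch_base * bch_base ^ length w" by simp
  have "nc_coeff (bch_base ^ length (x # w)) (x # w) =
      (\<Sum>s\<in>{1}. nc_coeff bch_base (take s (x # w)) * nc_coeff (bch_base ^ length w) (drop s (x # w)))"
    unfolding power nc_coeff_times
  proof (rule sum.mono_neutral_right)
    show "\<forall>s\<in>{..length (x # w)} - {1}.
      nc_coeff bch_base (take s (x # w)) * nc_coeff (bch_base ^ length w) (drop s (x # w)) = 0"
    proof
      fix s assume "s \<in> {..length (x # w)} - {1}"
      then have "s = 0 \<or> length (drop s (x # w)) < length w" by auto
      then show "nc_coeff bch_base (take s (x # w)) * nc_coeff (bch_base ^ length w) (drop s (x # w)) = 0"
        using nc_coeff_base_power_eq_0[of "drop s (x # w)" "length w"]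
        by (auto simp: nc_coeff_bch_base)
    qed
  qed auto
  also have "\<dots> = 1"
    using Cons.IH nc_coeff_base_replicate[of 1 x] by simp
  finally show ?case .
qed

text \<open>
  A coefficient of \<open>X\<^sup>k\<close> is a sum of products of \<open>k\<close> coefficients of \<open>X\<close>, so a bound on
  denominators that is stable under sums and adds up under products passes from \<open>X\<close> to its
  powers. Bounds are encoded as a family of additively closed sets, indexed by the exponent \<open>k\<close>
  and the word length \<open>l\<close>; this replaces explicit sums over factorizations of words.
\<close>
lemma nc_coeff_power_filtration:
  fixes F :: "nat \<Rightarrow> nat \<Rightarrow> rat set"
  assumes zero: "\<And>k l. 0 \<in> F k l"
    and add: "\<And>k l x y. x \<in> F k l \<Longrightarrow> y \<in> F k l \<Longrightarrow> x + y \<in> F k l"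
    and one: "1 \<in> F 0 0"
    and mult: "\<And>k l k' l' x y. x \<in> F k l \<Longrightarrow> y \<in> F k' l' \<Longrightarrow> x * y \<in> F (k + k') (l + l')"
    and X: "\<And>w. nc_coeff X w \<in> F 1 (length w)"
  shows "nc_coeff (X ^ k) w \<in> F k (length w)"
proof (induction k arbitrary: w)
  case 0
  then show ?case using zero one by (simp add: one_ncps.rep_eq)
next
  case (Suc k)
  have sum: "sum f A \<in> F k l" if "\<And>a. a \<in> A \<Longrightarrow> f a \<in> F k l"
    for f :: "letter list \<times> letter list \<Rightarrow> rat" and A k l
    using that by (induction A rule: infinite_finite_induct) (auto intro: zero add)
  have "nc_coeff X u * nc_coeff (X ^ k) v \<in> F (Suc k) (length w)" if "u @ v = w" for u v
    using mult[OF X[of u] Suc.IH[of v]] that by auto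
  then show ?case
    by (auto simp: times_ncps.rep_eq intro!: sum)
qed

section \<open>Integrality up to factorials\<close>

lemma fact_add_eq: "fact (a + b) = of_nat ((a + b) choose a) * (fact a * fact b :: rat)"
  using arg_cong[OF binomial_fact_lemma[of a "a + b"], of "of_nat :: nat \<Rightarrow> rat"]
  by (simp add: mult.commute)

text \<open>
  The sets of rationals whose denominator divides \<open>l!\<close> multiply as required because binomial
  coefficients are integers.
\<close>
lemma fact_times_nc_coeff_base_power_Ints:
  "fact (length w) * nc_coeff (bch_base ^ k) w \<in> \<int>"
proof -
  have "nc_coeff (bch_base ^ k) w \<in> {x. fact (length w) * x \<in> \<int>}"
  proof (rule nc_coeff_power_filtration[where F = "\<lambda>_ l. {x. fact l * x \<in> \<int>}"])
    fix l l' :: nat and x y :: rat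
    assume xy: "x \<in> {x. fact l * x \<in> \<int>}" "y \<in> {x. fact l' * x \<in> \<int>}"
    have "fact (l + l') * (x * y) = of_nat ((l + l') choose l) * ((fact l * x) * (fact l' * y))"
      by (simp add: fact_add_eq)
    also have "\<dots> \<in> \<int>" using xy by (intro Ints_mult[OF Ints_of_nat Ints_mult]) auto
    finally show "x * y \<in> {x. fact (l + l') * x \<in> \<int>}" by simp
  next
    fix w
    show "nc_coeff bch_base w \<in> {x. fact (length w) * x \<in> \<int>}"
    proof (cases rule: nc_coeff_bch_base_cases[of w])
      case (2 a b)
      then have "fact (length w) * nc_coeff bch_base w = of_nat ((a + b) choose a)"
        by (simp add: fact_add_eq)
      then show ?thesis by simp
    qed simp
  qed (auto simp: distrib_left)
  then show ?thesis by simp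
qed

text \<open>
  Covers every division made while the array is filled: \<open>c\<close> is the coefficient in the entry
  being divided, and the factorials belong to the prefix that is split off in front of a suffix
  of length \<open>l\<close>.
\<close>
lemma fact_mult_div_fact_Ints:
  fixes c :: rat
  assumes "fact l * c \<in> \<int>" "l + (a + b) \<le> n"
  shows "fact n * c / (fact a * fact b) \<in> \<int>"
proof -
  have "fact l * (fact a * fact b) dvd (fact l * fact (a + b) :: nat)"
    by (intro mult_dvd_mono fact_fact_dvd_fact) simp
  also have "\<dots> dvd fact (l + (a + b))" by (rule fact_fact_dvd_fact)
  also have "\<dots> dvd fact n" using assms(2) by (rule fact_dvd)
  finally obtain z where "fact n = fact l * (fact a * fact b) * (z :: nat)" by blast
  from arg_cong[OF this, of "of_nat :: nat \<Rightarrow> rat"]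
  have "fact n * c / (fact a * fact b) = of_nat z * (fact l * c)" by simp
  also have "\<dots> \<in> \<int>" by (rule Ints_mult[OF Ints_of_nat assms(1)])
  finally show ?thesis .
qed

section \<open>Digit sums and Legendre's formula\<close>

text \<open>
  The freedom to lengthen the range of digit positions makes the recursion \<open>digit_sum_rec\<close>
  available, in which the two sides have different natural ranges.
\<close>
lemma digit_sum_extend:
  assumes "2 \<le> p" "n \<le> N"
  shows "digit_sum p n = (\<Sum>i\<le>N. n div p ^ i mod p)"
  unfolding digit_sum_def
proof (rule sum.mono_neutral_left)
  show "\<forall>i\<in>{..N} - {..n}. n div p ^ i mod p = 0"
  proof
    fix i assume "i \<in> {..N} - {..n}"
    then have "n < i" by simp
    also have "i < p ^ i" using assms by (intro power_gt_expt) auto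
    finally show "n div p ^ i mod p = 0" by simp
  qed
qed (use assms in auto)

lemma digit_sum_0 [simp]: "digit_sum p 0 = 0"
  by (simp add: digit_sum_def)

lemma digit_sum_rec:
  assumes "2 \<le> p"
  shows "digit_sum p n = n mod p + digit_sum p (n div p)"
proof -
  have "digit_sum p n = (\<Sum>i\<le>Suc n. n div p ^ i mod p)"
    using assms by (rule digit_sum_extend) simp
  also have "\<dots> = n mod p + (\<Sum>i\<le>n. n div p div p ^ i mod p)"
    by (subst sum.atMost_Suc_shift) (simp add: div_mult2_eq)
  also have "\<dots> = n mod p + digit_sum p (n div p)"
    using digit_sum_extend[OF assms, of "n div p" n] by simp
  finally show ?thesis .
qed

lemma digit_sum_pos:
  assumes "2 \<le> p" "0 < n"
  shows "0 < digit_sum p n"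
  using assms(2)
proof (induction n rule: less_induct)
  case (less n)
  show ?case
  proof (cases "n < p")
    case True
    then show ?thesis using less.prems by (subst digit_sum_rec[OF assms(1)]) simp
  next
    case False
    then have "0 < n div p" "n div p < n" using assms less.prems by (auto simp: div_greater_zero_iff)
    from less.IH[OF this(2,1)] show ?thesis by (subst digit_sum_rec[OF assms(1)]) simp
  qed
qed

text \<open>
  Adding \<open>1\<close> turns each trailing digit \<open>p - 1\<close> into \<open>0\<close> and then raises the next digit by one; the
  number of trailing digits affected is the multiplicity of \<open>p\<close> in \<open>Suc n\<close>.
\<close>
lemma digit_sum_Suc:
  assumes "prime p"
  shows "digit_sum p (Suc n) + (p - 1) * multiplicity p (Suc n) = Suc (digit_sum p n)"
proof (induction n rule: less_induct)
  case (less n)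
  have p: "2 \<le> p" using assms by (rule prime_ge_2_nat)
  show ?case
  proof (cases "p dvd Suc n")
    case False
    then have "Suc n mod p = Suc (n mod p)" "Suc n div p = n div p"
      by (auto simp: mod_Suc div_Suc dvd_eq_mod_eq_0)
    moreover have "multiplicity p (Suc n) = 0"
      using False by (rule not_dvd_imp_multiplicity_0)
    ultimately show ?thesis
      using digit_sum_rec[OF p, of n] digit_sum_rec[OF p, of "Suc n"] by simp
  next
    case True
    then obtain c where c: "Suc n = p * c" by blast
    then obtain a where a: "c = Suc a" by (cases c) auto
    have n: "n = p * a + (p - 1)" using c a p by simp
    have "n div p = a" "n mod p = p - 1"
      unfolding n using p by (simp_all del: add_diff_assoc diff_Suc_1 add: div_eq_0_iff)
    moreover have "Suc n div p = Suc a" "Suc n mod p = 0" using c a p by simp_all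
    moreover have "multiplicity p (Suc n) = Suc (multiplicity p (Suc a))"
      unfolding c a using assms by (intro multiplicity_times_same) (auto simp: prime_gt_0_nat prime_nat_iff)
    moreover have "a < n"
    proof -
      have "a \<le> p * a" using p by simp
      then show ?thesis using n p by linarith
    qed
    ultimately show ?thesis
      using less.IH[of a] p digit_sum_rec[OF p, of n] digit_sum_rec[OF p, of "Suc n"] by simp
  qed
qed

text \<open>Legendre's formula, written without subtraction of digit sums.\<close>
lemma multiplicity_fact_digit_sum:
  assumes "prime p"
  shows "(p - 1) * multiplicity p (fact n :: nat) + digit_sum p n = n"
proof (induction n)
  case (Suc n)
  have "multiplicity p (fact (Suc n) :: nat) = multiplicity p (Suc n) + multiplicity p (fact n :: nat)"
    unfolding fact_Suc of_nat_id using assms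
    by (intro prime_elem_multiplicity_mult_distrib) (auto simp del: mult_Suc)
  then show ?case using Suc.IH digit_sum_Suc[OF assms, of n] by (simp add: algebra_simps)
qed simp

section \<open>Denominators at a single prime\<close>

text \<open>
  Membership in \<open>p\<^sup>-\<^sup>e \<int>\<^sub>(\<^sub>p\<^sub>)\<close>, that is, \<open>v\<^sub>p(x) \<ge> -e\<close>. This form includes \<open>x = 0\<close> without a
  convention about its valuation.
\<close>
definition p_local :: "nat \<Rightarrow> nat \<Rightarrow> rat \<Rightarrow> bool" where
  "p_local p e x \<longleftrightarrow> (\<exists>b::nat. \<not> p dvd b \<and> of_nat b * of_nat p ^ e * x \<in> \<int>)"

lemma p_local_mult:
  assumes "prime p" "p_local p e x" "p_local p e' y" "e + e' \<le> E"
  shows "p_local p E (x * y)"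
proof -
  obtain b b' where b: "\<not> p dvd b" "of_nat b * of_nat p ^ e * x \<in> \<int>"
      "\<not> p dvd b'" "of_nat b' * of_nat p ^ e' * y \<in> \<int>"
    using assms(2,3) by (auto simp: p_local_def)
  have E: "E = e + e' + (E - (e + e'))" using assms(4) by simp
  have "of_nat (b * b') * of_nat p ^ E * (x * y) =
      (of_nat b * of_nat p ^ e * x) * (of_nat b' * of_nat p ^ e' * y) * of_nat p ^ (E - (e + e'))"
    by (subst E) (simp add: power_add algebra_simps)
  also have "\<dots> \<in> \<int>" using b by auto
  finally show ?thesis
    unfolding p_local_def using b assms(1) by (meson prime_dvd_mult_iff)
qed

lemma p_local_add:
  assumes "prime p" "p_local p e x" "p_local p e y"
  shows "p_local p e (x + y)"
proof -
  obtain b b' where b: "\<not> p dvd b" "of_nat b * of_nat p ^ e * x \<in> \<int>"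
      "\<not> p dvd b'" "of_nat b' * of_nat p ^ e * y \<in> \<int>"
    using assms(2,3) by (auto simp: p_local_def)
  have "of_nat (b * b') * of_nat p ^ e * (x + y) =
      of_nat b' * (of_nat b * of_nat p ^ e * x) + of_nat b * (of_nat b' * of_nat p ^ e * y)"
    by (simp add: algebra_simps)
  also have "\<dots> \<in> \<int>" using b by (intro Ints_add Ints_mult[OF Ints_of_nat])
  finally show ?thesis
    unfolding p_local_def using b assms(1) by (meson prime_dvd_mult_iff)
qed

lemma p_local_inverse_nat:
  assumes "prime p" "0 < N"
  shows "p_local p (multiplicity p N) (1 / of_nat N)"
proof -
  define v where "v = multiplicity p N"
  obtain b where b: "N = p ^ v * b" "\<not> p dvd b"
    unfolding v_def using assms by (auto intro: multiplicity_decompose'[of N p])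
  have "of_nat N = (of_nat b * of_nat p ^ v :: rat)"
    by (subst b(1)) simp
  then have "of_nat b * of_nat p ^ v * (1 / of_nat N) = (1 :: rat)"
    using assms(2) by (metis divide_self_if less_numeral_extra(3) mult.right_neutral of_nat_eq_0_iff times_divide_eq_right)
  then show ?thesis unfolding p_local_def v_def[symmetric] using b(2) by (metis Ints_1)
qed

text \<open>
  The \<open>-1\<close> in the numerator is the gain that matters: by Legendre's formula it comes from the
  positive digit sum of \<open>a\<close> or \<open>b\<close>, and it accumulates to \<open>-k\<close> in the \<open>k\<close>-th power.
\<close>
lemma p_local_inverse_fact_fact:
  assumes "prime p" "0 < a + b"
  shows "p_local p ((a + b - 1) div (p - 1)) (1 / (fact a * fact b))"
proof -
  have p: "2 \<le> p" using assms(1) by (rule prime_ge_2_nat)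
  let ?v = "multiplicity p (fact a * fact b :: nat)"
  have "?v = multiplicity p (fact a :: nat) + multiplicity p (fact b :: nat)"
    using assms by (simp add: prime_elem_multiplicity_mult_distrib)
  then have "(p - 1) * ?v + (digit_sum p a + digit_sum p b) = a + b"
    using multiplicity_fact_digit_sum[OF assms(1), of a] multiplicity_fact_digit_sum[OF assms(1), of b]
    by (simp add: algebra_simps)
  moreover have "0 < digit_sum p a + digit_sum p b"
    using assms(2) digit_sum_pos[OF p] by (cases "a = 0") auto
  ultimately have "(p - 1) * ?v \<le> a + b - 1" by linarith
  then have "?v * (p - 1) \<le> a + b - 1" by (simp only: mult.commute)
  then have "?v \<le> (a + b - 1) div (p - 1)"
    using p by (simp add: less_eq_div_iff_mult_less_eq)
  then have "p_local p ((a + b - 1) div (p - 1)) (1 * (1 / of_nat (fact a * fact b)))"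
    using assms by (intro p_local_mult[where e = 0, OF _ _ p_local_inverse_nat])
      (auto simp: p_local_def intro!: exI[of _ 1])
  then show ?thesis by simp
qed

lemma div_add_le_div:
  fixes a b c :: nat
  shows "a div c + b div c \<le> (a + b) div c"
  by (subst div_add1_eq) simp

text \<open>
  Floors of quotients are superadditive, so the exponents \<open>(l - k) div (p - 1)\<close> define a
  filtration. Where \<open>k > l\<close> the truncated exponent would be wrong, but there the coefficients
  vanish; hence the disjunction in the choice of the sets.
\<close>
lemma p_local_nc_coeff_base_power:
  assumes "prime p" "k \<le> length w"
  shows "p_local p ((length w - k) div (p - 1)) (nc_coeff (bch_base ^ k) w)"
proof -
  let ?F = "\<lambda>k l. {x. x = 0 \<or> (k \<le> l \<and> p_local p ((l - k) div (p - 1)) x)}"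
  have zero: "p_local p e 0" for e
    using assms(1) by (auto simp: p_local_def intro!: exI[of _ 1])
  have "nc_coeff (bch_base ^ k) w \<in> ?F k (length w)"
  proof (rule nc_coeff_power_filtration)
    fix k l k' l' :: nat and x y :: rat
    assume xy: "x \<in> ?F k l" "y \<in> ?F k' l'"
    show "x * y \<in> ?F (k + k') (l + l')"
    proof (cases "x = 0 \<or> y = 0")
      case False
      then have le: "k \<le> l" "k' \<le> l'" using xy by auto
      then have "(l - k) + (l' - k') = l + l' - (k + k')" by simp
      then have "(l - k) div (p - 1) + (l' - k') div (p - 1) \<le> (l + l' - (k + k')) div (p - 1)"
        using div_add_le_div[of "l - k" "p - 1" "l' - k'"] by simp
      then have "p_local p ((l + l' - (k + k')) div (p - 1)) (x * y)"
        using xy False by (intro p_local_mult[OF assms(1)]) auto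
      then show ?thesis using le by simp
    qed auto
  next
    fix w
    show "nc_coeff bch_base w \<in> ?F 1 (length w)"
    proof (cases rule: nc_coeff_bch_base_cases[of w])
      case (2 a b)
      then show ?thesis using p_local_inverse_fact_fact[OF assms(1), of a b] by (simp add: Suc_le_eq)
    qed simp
  next
    show "1 \<in> ?F 0 0" using assms(1) by (auto simp: p_local_def intro!: exI[of _ 1])
  qed (auto intro: p_local_add[OF assms(1)])
  then show ?thesis using zero by auto
qed

text \<open>
  Here \<open>c\<close> is the coefficient in \<open>Y\<^sup>k\<close> of a word of length \<open>n\<close>. The bound on its denominators is
  strong enough that at each prime \<open>p\<close> the multiplicity in \<open>k\<close> exceeds that in \<open>n! c\<close> by at most the
  exponent of the largest power of \<open>p\<close> up to the digit sum of \<open>n\<close>. The primes \<open>p \<ge> n\<close> missing from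
  the product \<open>d_seq n\<close> do no harm, since there the digit sum is smaller than \<open>p\<close>.
\<close>
lemma dvd_mult_d_seq:
  fixes N :: int and c :: rat
  assumes n: "0 < n" and k: "0 < k" "k \<le> n"
    and c: "of_int N = fact n * c"
    and loc: "\<And>p. prime p \<Longrightarrow> p_local p ((n - k) div (p - 1)) c"
  shows "int k dvd int (d_seq n) * N"
proof (cases "N = 0")
  case False
  define M where "M = nat \<bar>N\<bar>"
  have "M \<noteq> 0" using False by (simp add: M_def)
  have d0: "d_seq n \<noteq> 0" by (auto simp: d_seq_def prime_gt_0_nat)
  have "k dvd d_seq n * M"
  proof (rule multiplicity_le_imp_dvd)
    show "k \<noteq> 0" using k by simp
  next
    fix p :: nat assume p: "prime p"
    have p2: "2 \<le> p" using p by (rule prime_ge_2_nat)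
    define e where "e = (n - k) div (p - 1)"
    define v where "v = multiplicity p (fact n :: nat)"
    define s where "s = digit_sum p n"
    define t where "t = multiplicity p k"
    define u where "u = multiplicity p M"
    define T where "T = Max {t. p ^ t \<le> s}"
    have legendre: "(p - 1) * v + s = n"
      unfolding v_def s_def by (rule multiplicity_fact_digit_sum[OF p])
    have "0 < s" unfolding s_def using p2 n by (rule digit_sum_pos)
    \<comment> \<open>Valuations of both sides of \<open>n! (b p\<^sup>e c) = b p\<^sup>e N\<close>, where \<open>b p\<^sup>e c\<close> is an integer.\<close>
    have "v \<le> e + u"
    proof -
      obtain b where b: "\<not> p dvd b" "of_nat b * of_nat p ^ e * c \<in> \<int>"
        using loc[OF p] by (auto simp: p_local_def e_def)
      then obtain z where z: "of_nat b * of_nat p ^ e * c = of_int z" by (auto elim: Ints_cases)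
      have "of_int (fact n * z) = (of_int (int b * int p ^ e * N) :: rat)"
        using z by (simp add: c)
      then have "fact n * z = int b * int p ^ e * N" by (simp only: of_int_eq_iff)
      have nat_fact: "nat (fact n) = fact n" by (metis nat_int of_nat_fact)
      from \<open>fact n * z = _\<close> have "nat \<bar>fact n * z\<bar> = nat \<bar>int b * int p ^ e * N\<bar>" by simp
      then have "fact n * nat \<bar>z\<bar> = b * (p ^ e * M)"
        unfolding M_def nat_abs_mult_distrib
        by (simp add: nat_power_eq nat_fact mult.assoc)
      moreover have "p ^ v dvd fact n" unfolding v_def by (rule multiplicity_dvd)
      ultimately have "p ^ v dvd b * (p ^ e * M)" by (metis dvd_mult2)
      moreover have "coprime (p ^ v) b"
        using prime_imp_coprime[OF p b(1)] by simp
      ultimately have "p ^ v dvd p ^ e * M" by (simp add: coprime_dvd_mult_right_iff)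
      then have "v \<le> multiplicity p (p ^ e * M)"
        using p \<open>M \<noteq> 0\<close> by (intro multiplicity_geI) (auto simp: prime_gt_0_nat)
      also have "\<dots> = e + u"
        using p \<open>M \<noteq> 0\<close> by (simp add: u_def prime_elem_multiplicity_mult_distrib multiplicity_same_power prime_gt_0_nat)
      finally show ?thesis .
    qed
    have "k \<le> s + (p - 1) * u"
    proof -
      have "(p - 1) * v \<le> (p - 1) * e + (p - 1) * u"
        using \<open>v \<le> e + u\<close> by (simp flip: distrib_left)
      moreover have "(p - 1) * e \<le> n - k" by (simp add: e_def)
      ultimately show ?thesis using legendre k by linarith
    qed
    have fin: "finite {t. p ^ t \<le> s}"
    proof (rule finite_subset)
      show "{t. p ^ t \<le> s} \<subseteq> {..s}"
      proof
        fix x assume "x \<in> {t. p ^ t \<le> s}"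
        moreover have "x < p ^ x" using p2 by (intro power_gt_expt) simp
        ultimately show "x \<in> {..s}" by simp
      qed
    qed simp
    have "s < p ^ Suc T"
    proof (rule ccontr)
      assume "\<not> s < p ^ Suc T"
      then have "Suc T \<le> T" unfolding T_def using fin by (intro Max_ge) auto
      then show False by simp
    qed
    have "p ^ T \<le> s"
    proof -
      have "0 \<in> {t. p ^ t \<le> s}" using \<open>0 < s\<close> by simp
      then have "T \<in> {t. p ^ t \<le> s}" unfolding T_def using Max_in[OF fin] by blast
      then show ?thesis by simp
    qed
    have "t \<le> T + u"
    proof (rule ccontr)
      assume "\<not> t \<le> T + u"
      have "p ^ Suc T + (p - 1) * u \<le> p ^ Suc T * (1 + u * (p - 1))"
      proof -
        have "1 * (u * (p - 1)) \<le> p ^ Suc T * (u * (p - 1))"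
          using p2 by (intro mult_le_mono1) (simp add: Suc_le_eq)
        then show ?thesis by (simp only: distrib_left mult_1 mult_1_right mult.commute[of u] add_le_cancel_left)
      qed
      also have "\<dots> \<le> p ^ Suc T * p ^ u"
      proof -
        \<comment> \<open>Bernoulli's inequality.\<close>
        have "1 + u * (p - 1) \<le> p ^ u"
        proof (induction u)
          case (Suc u)
          have "1 + Suc u * (p - 1) \<le> (1 + u * (p - 1)) * p"
            using p2 by (cases p) (auto simp: algebra_simps)
          then show ?case using mult_le_mono1[OF Suc.IH, of p] by (simp add: mult.commute)
        qed simp
        then show ?thesis by (rule mult_le_mono2)
      qed
      also have "\<dots> = p ^ (Suc T + u)" by (simp add: power_add)
      also have "\<dots> \<le> p ^ t" using \<open>\<not> t \<le> T + u\<close> p2 by (intro power_increasing) auto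
      also have "\<dots> \<le> k" unfolding t_def using k by (intro dvd_imp_le multiplicity_dvd) auto
      finally show False using \<open>k \<le> s + _\<close> \<open>s < _\<close> by linarith
    qed
    moreover have "T \<le> multiplicity p (d_seq n)"
    proof (cases "p < n")
      case True
      have "p ^ T dvd d_seq n"
        unfolding d_seq_def T_def s_def using True p
        by (intro dvd_prodI) auto
      then show ?thesis using p d0 by (intro multiplicity_geI) (auto simp: prime_gt_0_nat)
    next
      case False
      \<comment> \<open>If \<open>p = n\<close>, then \<open>p\<close> divides \<open>n!\<close>, and Legendre's formula gives digit sum \<open>1\<close>.\<close>
      have "s < p"
      proof (cases "p = n")
        case True
        then have "p dvd fact n" using p2 by (simp add: dvd_fact)
        then have "1 \<le> v" unfolding v_def using p by (intro multiplicity_geI) (auto simp: prime_gt_0_nat)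
        then have "p - 1 \<le> (p - 1) * v" by simp
        then show ?thesis using legendre True p2 by linarith
      qed (use False legendre in linarith)
      then have "p ^ T < p ^ 1" using \<open>p ^ T \<le> s\<close> by simp
      then have "T < 1" using p2 by (subst (asm) power_strict_increasing_iff) auto
      then show ?thesis by simp
    qed
    ultimately show "multiplicity p k \<le> multiplicity p (d_seq n * M)"
      using p d0 \<open>M \<noteq> 0\<close> by (simp add: t_def u_def prime_elem_multiplicity_mult_distrib)
  qed
  then have "int k dvd int (d_seq n * M)" by (simp only: int_dvd_int_iff)
  moreover have "int (d_seq n * M) = \<bar>int (d_seq n) * N\<bar>" by (simp add: M_def abs_mult)
  ultimately show ?thesis by (simp only: dvd_abs_iff)
qed simp

section \<open>Words in blocks\<close>

definition block_tail :: "nat \<Rightarrow> (nat \<Rightarrow> nat) \<Rightarrow> bool \<Rightarrow> nat \<Rightarrow> letter list" where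
  "block_tail m q Afirst i =
     concat (map (\<lambda>i. replicate (q i) (if A_block Afirst i then LA else LB)) [i..<Suc m])"

lemma length_block_tail: "length (block_tail m q Afirst i) = (\<Sum>t = i..m. q t)"
  by (simp add: block_tail_def length_concat comp_def interv_sum_list_conv_sum_set_nat
      atLeastLessThanSuc_atLeastAtMost del: upt_Suc)

lemma block_tail_rec:
  "i \<le> m \<Longrightarrow> block_tail m q Afirst i =
     replicate (q i) (if A_block Afirst i then LA else LB) @ block_tail m q Afirst (Suc i)"
  by (simp add: block_tail_def upt_conv_Cons del: upt_Suc)

lemma block_tail_empty: "m < i \<Longrightarrow> block_tail m q Afirst i = []"
  by (simp add: block_tail_def)

lemma hd_block_tail:
  "i \<le> m \<Longrightarrow> 0 < q i \<Longrightarrow> hd (block_tail m q Afirst i) = (if A_block Afirst i then LA else LB)"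
  by (simp add: block_tail_rec)

lemma A_block_Suc: "A_block Afirst (Suc i) \<longleftrightarrow> \<not> A_block Afirst i"
  by (auto simp: A_block_def)

lemma length_block_word: "length (block_word m q Afirst) = (\<Sum>i = 1..m. q i)"
  using length_block_tail[of m q Afirst 1] by (simp add: block_word_def block_tail_def)

definition suffix_of_length :: "nat \<Rightarrow> 'a list \<Rightarrow> 'a list" where
  "suffix_of_length l w = drop (length w - l) w"

lemma length_suffix_of_length: "l \<le> length w \<Longrightarrow> length (suffix_of_length l w) = l"
  by (simp add: suffix_of_length_def)

lemma drop_suffix_of_length:
  "s \<le> l \<Longrightarrow> l \<le> length w \<Longrightarrow> drop s (suffix_of_length l w) = suffix_of_length (l - s) w"
  by (simp add: suffix_of_length_def add.commute)

lemma position_le: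
  assumes "1 \<le> i" "i \<le> m" "r \<le> q i"
  shows "position m q i r \<le> (\<Sum>i = 1..m. q i)"
proof -
  have "position m q i r \<le> (\<Sum>t = i..m. q t)"
    using assms by (simp add: position_def sum.atLeast_Suc_atMost)
  also have "\<dots> \<le> (\<Sum>i = 1..m. q i)"
    using assms by (intro sum_mono2) auto
  finally show ?thesis .
qed

lemma suffix_block_word:
  assumes "1 \<le> i" "i \<le> m" "r \<le> q i"
  shows "suffix_of_length (position m q i r) (block_word m q Afirst) =
    replicate r (if A_block Afirst i then LA else LB) @ block_tail m q Afirst (Suc i)"
proof -
  let ?x = "if A_block Afirst i then LA else LB"
  let ?pre = "concat (map (\<lambda>i. replicate (q i) (if A_block Afirst i then LA else LB)) [1..<i])"
  have "[1..<Suc m] = [1..<i] @ [i..<Suc m]"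
    using assms upt_add_eq_append[of 1 i "Suc m - i"] by (simp del: upt_Suc)
  then have "block_word m q Afirst = ?pre @ block_tail m q Afirst i"
    by (simp add: block_word_def block_tail_def del: upt_Suc)
  also have "\<dots> = (?pre @ replicate (q i - r) ?x) @ (replicate r ?x @ block_tail m q Afirst (Suc i))"
    using assms by (simp add: block_tail_rec flip: replicate_add)
  finally have eq: "block_word m q Afirst = \<dots>" .
  have "length (replicate r ?x @ block_tail m q Afirst (Suc i)) = position m q i r"
    by (simp add: length_block_tail position_def)
  then show ?thesis unfolding eq suffix_of_length_def by simp
qed

text \<open>
  The case distinction of the algorithm. A longer prefix contains a \<open>B\<close> followed by an \<open>A\<close>: at the
  end of the first block if this is a \<open>B\<close>-block, and otherwise at the end of the second.
\<close>
lemma nc_coeff_base_take_blocks: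
  assumes q: "\<forall>i\<in>{1..m}. 0 < q i" and i: "1 \<le> i" "i \<le> m"
    and s: "1 \<le> s" "s \<le> position m q i r" and r: "0 < r"
  shows "nc_coeff bch_base (take s
      (replicate r (if A_block Afirst i then LA else LB) @ block_tail m q Afirst (Suc i))) =
    (if s \<le> r then 1 / fact s
     else if i < m \<and> A_block Afirst i \<and> s \<le> r + q (i + 1) then 1 / (fact r * fact (s - r))
     else 0)"
proof (cases "s \<le> r")
  case True
  then show ?thesis using s by (simp add: nc_coeff_base_replicate min_def)
next
  case False
  let ?T = "block_tail m q Afirst"
  have len: "s \<le> r + length (?T (Suc i))"
    using s by (simp add: position_def length_block_tail)
  with False have "?T (Suc i) \<noteq> []" by auto
  then have im: "i < m" using block_tail_empty[of m "Suc i"] by (meson not_le le_imp_less_Suc)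
  with q have qs: "0 < q (Suc i)" by simp
  show ?thesis
  proof (cases "A_block Afirst i")
    case False
    then show ?thesis
      using \<open>\<not> s \<le> r\<close> len im qs r nc_coeff_base_B_block[of r s "?T (Suc i)"]
      by (simp add: hd_block_tail A_block_Suc)
  next
    case True
    have T: "?T (Suc i) = replicate (q (Suc i)) LB @ ?T (Suc (Suc i))"
      using im True by (simp add: block_tail_rec A_block_Suc)
    show ?thesis
    proof (cases "s \<le> r + q (Suc i)")
      case le: True
      then have "take s (replicate r LA @ ?T (Suc i)) = replicate r LA @ replicate (s - r) LB"
        using \<open>\<not> s \<le> r\<close> by (simp add: T min_def)
      then show ?thesis
        using \<open>\<not> s \<le> r\<close> le im True r by (simp add: nc_coeff_base_A_B_blocks)
    next
      case gt: False
      have len': "s \<le> r + q (Suc i) + length (?T (Suc (Suc i)))" using len T by simp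
      with gt have "?T (Suc (Suc i)) \<noteq> []" by auto
      then have "Suc (Suc i) \<le> m" using block_tail_empty[of m "Suc (Suc i)"] by (meson not_le)
      moreover from this q have "0 < q (Suc (Suc i))" by simp
      ultimately have "hd (?T (Suc (Suc i))) = LA"
        using True by (simp add: hd_block_tail A_block_Suc)
      from nc_coeff_base_A_B_A_blocks[OF qs _ len' this] show ?thesis
        using gt \<open>\<not> s \<le> r\<close> True T by simp
    qed
  qed
qed

lemma bch_first_eq:
  assumes q: "\<forall>i\<in>{1..m}. 0 < q i" and i: "1 \<le> i" "i \<le> m" and r: "0 < r" "r \<le> q i"
  shows "bch_first d m q Afirst i r =
    of_nat d * nc_coeff bch_base (suffix_of_length (position m q i r) (block_word m q Afirst))"
proof -
  let ?l = "position m q i r"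
  let ?W = "replicate r (if A_block Afirst i then LA else LB) @ block_tail m q Afirst (Suc i)"
  have len: "length ?W = ?l" by (simp add: position_def length_block_tail)
  have rl: "r \<le> ?l" by (simp add: position_def)
  have "nc_coeff bch_base ?W = nc_coeff bch_base (take ?l ?W)" using len by simp
  also have "\<dots> = (if ?l \<le> r then 1 / fact ?l
     else if i < m \<and> A_block Afirst i \<and> ?l \<le> r + q (i + 1) then 1 / (fact r * fact (?l - r))
     else 0)"
    using q i r rl by (intro nc_coeff_base_take_blocks) auto
  finally have eq: "nc_coeff bch_base ?W = \<dots>" .
  consider "i = m" | "i + 1 = m" | "i + 1 < m" using i by linarith
  then show ?thesis
  proof cases
    case 1
    then show ?thesis using i r eq suffix_block_word[of i m r q Afirst]
      by (simp add: bch_first_def position_def)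
  next
    case 2
    then have "?l = r + q m" by (auto simp: position_def)
    moreover have "0 < q m" using 2 q by auto
    ultimately show ?thesis
      using 2 i r eq suffix_block_word[of i m r q Afirst] by (auto simp: bch_first_def)
  next
    case 3
    have "(\<Sum>t = i + 1..m. q t) = q (i + 1) + (q (i + 2) + (\<Sum>t = i + 3..m. q t))"
      using 3 by (simp add: sum.atLeast_Suc_atMost numeral_eq_Suc)
    moreover have "0 < q (i + 2)" using 3 q by auto
    ultimately have "r + q (i + 1) < ?l" by (simp add: position_def)
    then show ?thesis
      using 3 i r eq suffix_block_word[of i m r q Afirst] by (simp add: bch_first_def)
  qed
qed

section \<open>The array\<close>

text \<open>
  The loop invariant: the contents of the array when columns \<open>1, \<dots>, t\<close> have been filled.
  Entries with \<open>k > l\<close> need no separate case, because the coefficient is then \<open>0\<close>.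
\<close>
definition coeff_array :: "nat \<Rightarrow> letter list \<Rightarrow> nat \<Rightarrow> nat \<times> nat \<Rightarrow> rat" where
  "coeff_array d w t = (\<lambda>(k, l). if 1 \<le> k \<and> 1 \<le> l \<and> l \<le> t
     then of_nat d * nc_coeff (bch_base ^ k) (suffix_of_length l w) else 0)"

lemma bch_entry_eq:
  assumes q: "\<forall>i\<in>{1..m}. 0 < q i" and i: "1 \<le> i" "i \<le> m" and r: "0 < r" "r \<le> q i"
    and t: "position m q i r = Suc t" and k: "2 \<le> k"
    and w: "w = block_word m q Afirst"
  shows "bch_entry m q Afirst i r (coeff_array d w t) k =
    of_nat d * nc_coeff (bch_base ^ k) (suffix_of_length (Suc t) w)"
proof -
  let ?l = "Suc t"
  let ?C = "coeff_array d w t"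
  define W where "W = suffix_of_length ?l w"
  obtain k' where k': "k = Suc k'" "0 < k'" using k by (cases k) auto
  define g where "g s = nc_coeff (bch_base ^ k') (suffix_of_length s w)" for s
  have l: "?l \<le> length w"
    using position_le[of i m r q] i r t by (simp add: w length_block_word)
  have W: "W = replicate r (if A_block Afirst i then LA else LB) @ block_tail m q Afirst (Suc i)"
    unfolding W_def w t[symmetric] using i r by (intro suffix_block_word)
  have lenW: "length W = ?l" using l by (simp add: W_def length_suffix_of_length)
  have C: "?C (k', s) = of_nat d * g s" if "1 \<le> s" "s < ?l" for s
    using that k'(2) by (simp add: coeff_array_def g_def)
  define J1 where "J1 = {j. 1 \<le> j \<and> j \<le> r \<and> j < ?l}"
  define J2 where "J2 = {j. 1 \<le> j \<and> j \<le> q (i + 1) \<and> r + j < ?l}"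
  have fin: "finite J1" "finite J2" by (simp_all add: J1_def J2_def)
  let ?b = "i < m \<and> A_block Afirst i"
  have "nc_coeff (bch_base ^ k) W = (\<Sum>s = 1..<?l. nc_coeff bch_base (take s W) * g (?l - s))"
    unfolding k'(1) nc_coeff_base_power_Suc[OF k'(2)] lenW
    by (intro sum.cong) (use l in \<open>auto simp: W_def g_def drop_suffix_of_length\<close>)
  also have "\<dots> = (\<Sum>s = 1..<?l. (if s \<le> r then g (?l - s) / fact s else 0) +
      (if r < s \<and> ?b \<and> s \<le> r + q (i + 1) then g (?l - s) / (fact r * fact (s - r)) else 0))"
  proof (rule sum.cong)
    fix s assume "s \<in> {1..<?l}"
    then have "nc_coeff bch_base (take s W) = (if s \<le> r then 1 / fact s
     else if ?b \<and> s \<le> r + q (i + 1) then 1 / (fact r * fact (s - r)) else 0)"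
      unfolding W using q i r t by (subst nc_coeff_base_take_blocks) auto
    then show "nc_coeff bch_base (take s W) * g (?l - s) = (if s \<le> r then g (?l - s) / fact s else 0) +
      (if r < s \<and> ?b \<and> s \<le> r + q (i + 1) then g (?l - s) / (fact r * fact (s - r)) else 0)"
      by auto
  qed simp
  also have "\<dots> = (\<Sum>s = 1..<?l. if s \<le> r then g (?l - s) / fact s else 0) +
      (\<Sum>s = 1..<?l. if r < s \<and> ?b \<and> s \<le> r + q (i + 1) then g (?l - s) / (fact r * fact (s - r)) else 0)"
    by (rule sum.distrib)
  also have "(\<Sum>s = 1..<?l. if s \<le> r then g (?l - s) / fact s else 0) = (\<Sum>j\<in>J1. g (?l - j) / fact j)"
    by (rule sum.mono_neutral_cong_right) (auto simp: J1_def)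
  also have "(\<Sum>s = 1..<?l. if r < s \<and> ?b \<and> s \<le> r + q (i + 1) then g (?l - s) / (fact r * fact (s - r)) else 0)
      = (if ?b then \<Sum>j\<in>J2. g (?l - r - j) / (fact r * fact j) else 0)"
  proof (cases ?b)
    case True
    have "(\<Sum>s = 1..<?l. if r < s \<and> ?b \<and> s \<le> r + q (i + 1) then g (?l - s) / (fact r * fact (s - r)) else 0)
      = (\<Sum>s | r < s \<and> s \<le> r + q (i + 1) \<and> s < ?l. g (?l - s) / (fact r * fact (s - r)))"
      by (rule sum.mono_neutral_cong_right) (use True in auto)
    also have "\<dots> = (\<Sum>j\<in>J2. g (?l - r - j) / (fact r * fact j))"
      by (rule sum.reindex_bij_witness[of _ "\<lambda>j. r + j" "\<lambda>s. s - r"]) (auto simp: J2_def)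
    finally show ?thesis using True by simp
  qed auto
  finally have coeff: "nc_coeff (bch_base ^ k) W =
      (\<Sum>j\<in>J1. g (?l - j) / fact j) + (if ?b then \<Sum>j\<in>J2. g (?l - r - j) / (fact r * fact j) else 0)" .
  have "(\<Sum>j | 1 \<le> j \<and> j \<le> r \<and> j < ?l \<and> ?C (k', ?l - j) \<noteq> 0. ?C (k', ?l - j) / fact j)
      = (\<Sum>j\<in>J1. ?C (k', ?l - j) / fact j)"
    by (rule sum.mono_neutral_left) (use fin in \<open>auto simp: J1_def\<close>)
  also have "\<dots> = of_nat d * (\<Sum>j\<in>J1. g (?l - j) / fact j)"
    unfolding sum_distrib_left by (rule sum.cong) (auto simp: J1_def C)
  finally have 1: "(\<Sum>j | 1 \<le> j \<and> j \<le> r \<and> j < ?l \<and> ?C (k', ?l - j) \<noteq> 0. ?C (k', ?l - j) / fact j)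
      = of_nat d * (\<Sum>j\<in>J1. g (?l - j) / fact j)" .
  have "(\<Sum>j | 1 \<le> j \<and> j \<le> q (i + 1) \<and> r + j < ?l \<and> ?C (k', ?l - r - j) \<noteq> 0.
                ?C (k', ?l - r - j) / (fact r * fact j))
      = (\<Sum>j\<in>J2. ?C (k', ?l - r - j) / (fact r * fact j))"
    by (rule sum.mono_neutral_left) (use fin in \<open>auto simp: J2_def\<close>)
  also have "\<dots> = of_nat d * (\<Sum>j\<in>J2. g (?l - r - j) / (fact r * fact j))"
    unfolding sum_distrib_left
  proof (rule sum.cong)
    fix j assume "j \<in> J2"
    then have "1 \<le> ?l - r - j" "?l - r - j < ?l" by (auto simp: J2_def)
    from C[OF this] show "?C (k', ?l - r - j) / (fact r * fact j) =
        of_nat d * (g (?l - r - j) / (fact r * fact j))" by simp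
  qed simp
  finally have 2: "(\<Sum>j | 1 \<le> j \<and> j \<le> q (i + 1) \<and> r + j < ?l \<and> ?C (k', ?l - r - j) \<noteq> 0.
                ?C (k', ?l - r - j) / (fact r * fact j))
      = of_nat d * (\<Sum>j\<in>J2. g (?l - r - j) / (fact r * fact j))" .
  have k_pred: "k - 1 = k'" using k' by simp
  show ?thesis
    unfolding bch_entry_def Let_def t k_pred 1 2 W_def[symmetric] coeff by (simp add: distrib_left)
qed

lemma bch_entry_cong:
  assumes "\<And>k l. l \<noteq> position m q i r \<Longrightarrow> C (k, l) = C' (k, l)"
  shows "bch_entry m q Afirst i r C k = bch_entry m q Afirst i r C' k"
proof -
  let ?l = "position m q i r"
  have 1: "C (k - 1, ?l - j) = C' (k - 1, ?l - j)" if "1 \<le> j" "j < ?l" for j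
    using that by (intro assms) auto
  have 2: "C (k - 1, ?l - r - j) = C' (k - 1, ?l - r - j)" if "1 \<le> j" "r + j < ?l" for j
    using that by (intro assms) auto
  have "(\<Sum>j | 1 \<le> j \<and> j \<le> r \<and> j < ?l \<and> C (k - 1, ?l - j) \<noteq> 0. C (k - 1, ?l - j) / fact j) =
      (\<Sum>j | 1 \<le> j \<and> j \<le> r \<and> j < ?l \<and> C' (k - 1, ?l - j) \<noteq> 0. C' (k - 1, ?l - j) / fact j)"
    by (rule sum.cong) (use 1 in auto)
  moreover have "(\<Sum>j | 1 \<le> j \<and> j \<le> q (i + 1) \<and> r + j < ?l \<and> C (k - 1, ?l - r - j) \<noteq> 0.
                C (k - 1, ?l - r - j) / (fact r * fact j)) =
      (\<Sum>j | 1 \<le> j \<and> j \<le> q (i + 1) \<and> r + j < ?l \<and> C' (k - 1, ?l - r - j) \<noteq> 0.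
                C' (k - 1, ?l - r - j) / (fact r * fact j))"
    by (rule sum.cong) (use 2 in auto)
  ultimately show ?thesis unfolding bch_entry_def Let_def by simp
qed

text \<open>
  An inner loop that fills column \<open>l\<close> from entries outside column \<open>l\<close> never reads what it has
  written, so its effect can be described all at once.
\<close>
lemma fold_column_update:
  fixes C :: "'k \<times> 'l \<Rightarrow> 'a"
  assumes "\<And>C C' k. (\<And>k' l'. l' \<noteq> l \<Longrightarrow> C (k', l') = C' (k', l')) \<Longrightarrow> e C k = e C' k"
  shows "fold (\<lambda>k C. C((k, l) := e C k)) ks C =
    (\<lambda>(k', l'). if l' = l \<and> k' \<in> set ks then e C k' else C (k', l'))"
proof (induction ks arbitrary: C)
  case (Cons k ks)
  have "e (C((k, l) := e C k)) k' = e C k'" for k' by (rule assms) simp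
  then show ?case unfolding fold_Cons comp_def Cons.IH by (auto simp: fun_eq_iff)
qed auto

lemma bch_step_coeff_array:
  assumes q: "\<forall>i\<in>{1..m}. 0 < q i" and i: "1 \<le> i" "i \<le> m" and r: "0 < r" "r \<le> q i"
    and t: "position m q i r = Suc t"
    and w: "w = block_word m q Afirst"
  shows "bch_step d m q Afirst (i, r) (coeff_array d w t) = coeff_array d w (Suc t)"
proof (rule ext, clarify)
  fix k l
  let ?C = "coeff_array d w t"
  let ?C1 = "?C((1, Suc t) := bch_first d m q Afirst i r)"
  have entry: "bch_entry m q Afirst i r ?C1 k = bch_entry m q Afirst i r ?C k" for k
    by (rule bch_entry_cong) (simp add: t)
  have len: "length (suffix_of_length (Suc t) w) = Suc t"
    using position_le[of i m r q] i r t by (simp add: w length_block_word length_suffix_of_length)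
  have step: "bch_step d m q Afirst (i, r) ?C =
      (\<lambda>(k', l'). if l' = Suc t \<and> k' \<in> set [2..<Suc t]
         then bch_entry m q Afirst i r ?C1 k' else ?C1 (k', l'))((Suc t, Suc t) := of_nat d)"
    unfolding bch_step_def Let_def prod.case t
    by (subst fold_column_update) (auto intro: bch_entry_cong simp: t)
  consider "l \<noteq> Suc t" | "l = Suc t" "k = Suc t" | "l = Suc t" "k = 1" "k < Suc t"
    | "l = Suc t" "k = 0" | "l = Suc t" "2 \<le> k" "k < Suc t" | "l = Suc t" "Suc t < k"
    by linarith
  then show "bch_step d m q Afirst (i, r) ?C (k, l) = coeff_array d w (Suc t) (k, l)"
  proof cases
    case 1
    then show ?thesis unfolding step by (auto simp: coeff_array_def)
  next
    case 2
    then show ?thesis using nc_coeff_base_power_length[of "suffix_of_length (Suc t) w"]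
      unfolding step by (simp add: coeff_array_def len del: power_Suc)
  next
    case 3
    then show ?thesis using bch_first_eq[OF q i r, of d Afirst]
      unfolding step by (simp add: coeff_array_def t w)
  next
    case 4
    then show ?thesis unfolding step by (simp add: coeff_array_def)
  next
    case 5
    then have "bch_step d m q Afirst (i, r) ?C (k, l) = bch_entry m q Afirst i r ?C1 k"
      unfolding step by simp
    also have "\<dots> = of_nat d * nc_coeff (bch_base ^ k) (suffix_of_length (Suc t) w)"
      unfolding entry using 5(2) by (intro bch_entry_eq q i r t w)
    finally show ?thesis using 5 by (simp add: coeff_array_def)
  next
    case 6
    then show ?thesis using nc_coeff_base_power_eq_0[of "suffix_of_length (Suc t) w" k]
      unfolding step by (simp add: coeff_array_def len)
  qed
qed

lemma fold_bch_step:
  assumes q: "\<forall>i\<in>{1..m}. 0 < q i" and w: "w = block_word m q Afirst"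
    and "map (\<lambda>(i, r). position m q i r) ps = [1..<Suc t]"
    and "\<forall>(i, r)\<in>set ps. 1 \<le> i \<and> i \<le> m \<and> 0 < r \<and> r \<le> q i"
  shows "fold (bch_step d m q Afirst) ps (\<lambda>_. 0) = coeff_array d w t"
  using assms(3,4)
proof (induction t arbitrary: ps)
  case 0
  then show ?case by (auto simp: coeff_array_def fun_eq_iff)
next
  case (Suc t)
  have "[1..<Suc (Suc t)] = [1..<Suc t] @ [Suc t]" by simp
  with Suc.prems(1) have map: "map (\<lambda>(i, r). position m q i r) ps = [1..<Suc t] @ [Suc t]"
    by (simp only:)
  then have "ps \<noteq> []" by auto
  then obtain ps' i r where ps': "ps = ps' @ [(i, r)]"
    by (metis rev_exhaust surj_pair)
  with map have "map (\<lambda>(i, r). position m q i r) ps' @ [position m q i r] = [1..<Suc t] @ [Suc t]"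
    by (simp only: map_append list.map prod.case)
  with ps' have ps: "ps = ps' @ [(i, r)]"
      "map (\<lambda>(i, r). position m q i r) ps' = [1..<Suc t]" "position m q i r = Suc t"
    by (simp_all only: append1_eq_conv)
  have "fold (bch_step d m q Afirst) ps' (\<lambda>_. 0) = coeff_array d w t"
    using Suc.prems(2) ps by (intro Suc.IH) auto
  moreover have "1 \<le> i" "i \<le> m" "0 < r" "r \<le> q i" using Suc.prems(2) ps by auto
  ultimately show ?case using bch_step_coeff_array[OF q _ _ _ _ ps(3) w] ps(1) by simp
qed

lemma bch_array_eq:
  assumes q: "\<forall>i\<in>{1..m}. 0 < q i" and n: "n = (\<Sum>i = 1..m. q i)"
    and "1 \<le> k" "1 \<le> l" "l \<le> n"
  shows "bch_array m q Afirst (k, l) = of_nat (fact n * d_seq n) *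
    nc_coeff (bch_base ^ k) (suffix_of_length l (block_word m q Afirst))"
proof -
  have "\<forall>(i, r)\<in>set (loop_pairs m q). 1 \<le> i \<and> i \<le> m \<and> 0 < r \<and> r \<le> q i"
    by (auto simp: loop_pairs_def simp del: upt_Suc)
  from fold_bch_step[OF q refl loop_pairs_positions this] show ?thesis
    unfolding bch_array_def Let_def n[symmetric] using assms(3-5) by (simp add: coeff_array_def)
qed

theorem mainTheorem1:
  fixes m n d :: nat and q :: "nat \<Rightarrow> nat" and Afirst :: bool
    and w :: "letter list" and C :: "nat \<times> nat \<Rightarrow> rat"
  assumes "m \<ge> 1"
    and "\<forall>i\<in>{1..m}. q i > 0"
    and "n = (\<Sum>i = 1..m. q i)"
    and "d = fact n * d_seq n"
    and "w = block_word m q Afirst"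
    and "C = bch_array m q Afirst"
  shows
    "bch_algorithm m q Afirst = nc_coeff bch_series w
     \<and> nc_coeff bch_series w = 1 / of_nat d * (\<Sum>k = 1..n. (-1) ^ (k + 1) * C (k, n) / of_nat k)
     \<and> (\<forall>i\<in>{1..m}. \<forall>r\<in>{1..q i}. \<forall>l. l = r + (\<Sum>t = i + 1..m. q t) \<longrightarrow>
          (i = m \<longrightarrow> of_nat d / fact l \<in> (\<int> :: rat set))
        \<and> (i + 1 = m \<and> A_block Afirst i \<longrightarrow> of_nat d / (fact r * fact (q m)) \<in> (\<int> :: rat set))
        \<and> (\<forall>k\<in>{2..<l}. \<forall>j. 1 \<le> j \<and> j \<le> r \<and> j < l \<and> C (k - 1, l - j) \<noteq> 0 \<longrightarrow>
             C (k - 1, l - j) / fact j \<in> \<int>)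
        \<and> (i < m \<and> A_block Afirst i \<longrightarrow>
             (\<forall>k\<in>{2..<l}. \<forall>j. 1 \<le> j \<and> j \<le> q (i + 1) \<and> r + j < l \<and> C (k - 1, l - r - j) \<noteq> 0 \<longrightarrow>
                C (k - 1, l - r - j) / (fact r * fact j) \<in> \<int>)))
     \<and> (\<forall>k\<in>{1..n}. C (k, n) / of_nat k \<in> \<int>)
     \<and> (\<forall>k\<in>{1..n}. \<forall>l\<in>{1..n}. C (k, l) \<in> \<int>)"
proof -
  have lenw: "length w = n" using assms by (simp add: length_block_word)
  have "0 < d_seq n" by (auto simp: d_seq_def intro!: prod_pos dest: prime_gt_0_nat)
  then have "d \<noteq> 0" using assms(4) by simp
  have "0 < q 1" "q 1 \<le> n"
    using assms(1,2) unfolding assms(3) by (auto intro!: member_le_sum)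
  then have n: "0 < n" by simp
  have C: "C (k, l) = of_nat d * nc_coeff (bch_base ^ k) (suffix_of_length l w)"
    if "1 \<le> k" "1 \<le> l" "l \<le> n" for k l
    unfolding assms(4-6) using assms(2,3) that by (rule bch_array_eq)
  have Cn: "C (k, n) = of_nat d * nc_coeff (bch_base ^ k) w" if "1 \<le> k" for k
    using C[of k n] that n lenw by (simp add: suffix_of_length_def)
  have series: "nc_coeff bch_series w =
      1 / of_nat d * (\<Sum>k = 1..n. (-1) ^ (k + 1) * C (k, n) / of_nat k)"
    unfolding nc_coeff_bch_series lenw sum_distrib_left
    by (rule sum.cong) (use \<open>d \<noteq> 0\<close> in \<open>auto simp: Cn\<close>)
  have alg: "bch_algorithm m q Afirst = nc_coeff bch_series w"
    unfolding series bch_algorithm_def Let_def assms(3,4,6) by simp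
  \<comment> \<open>The initial divisions of \<open>d\<close> itself are the case of the empty suffix, \<open>l = 0\<close> and \<open>c = 1\<close>.\<close>
  have d_div: "of_nat d * c / (fact a * fact b) \<in> \<int>"
    if "fact l * c \<in> \<int>" "l + (a + b) \<le> n" for c :: rat and l a b
  proof -
    have "of_nat d * c / (fact a * fact b) = of_nat (d_seq n) * (fact n * c / (fact a * fact b))"
      by (simp add: assms(4))
    also have "\<dots> \<in> \<int>" using fact_mult_div_fact_Ints[OF that] by (intro Ints_mult) auto
    finally show ?thesis .
  qed
  have C_div: "C (k, l) / (fact a * fact b) \<in> \<int>"
    if "1 \<le> k" "1 \<le> l" "l + (a + b) \<le> n" for k l a b
  proof -
    have "fact l * nc_coeff (bch_base ^ k) (suffix_of_length l w) \<in> \<int>"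
      using fact_times_nc_coeff_base_power_Ints[of "suffix_of_length l w" k] that lenw
      by (simp add: length_suffix_of_length)
    from d_div[OF this that(3)] show ?thesis using that by (subst C) auto
  qed
  have steps: "(i = m \<longrightarrow> of_nat d / fact l \<in> (\<int> :: rat set))
        \<and> (i + 1 = m \<and> A_block Afirst i \<longrightarrow> of_nat d / (fact r * fact (q m)) \<in> (\<int> :: rat set))
        \<and> (\<forall>k\<in>{2..<l}. \<forall>j. 1 \<le> j \<and> j \<le> r \<and> j < l \<and> C (k - 1, l - j) \<noteq> 0 \<longrightarrow>
             C (k - 1, l - j) / fact j \<in> \<int>)
        \<and> (i < m \<and> A_block Afirst i \<longrightarrow>
             (\<forall>k\<in>{2..<l}. \<forall>j. 1 \<le> j \<and> j \<le> q (i + 1) \<and> r + j < l \<and> C (k - 1, l - r - j) \<noteq> 0 \<longrightarrow>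
                C (k - 1, l - r - j) / (fact r * fact j) \<in> \<int>))"
    if i: "i \<in> {1..m}" and r: "r \<in> {1..q i}" and l: "l = r + (\<Sum>t = i + 1..m. q t)" for i r l
  proof (intro conjI impI ballI allI)
    have ln: "l \<le> n"
      using position_le[of i m r q] i r unfolding l assms(3) position_def by simp
    show "of_nat d / fact l \<in> (\<int> :: rat set)"
      using d_div[of 0 1 l 0] ln by simp
    show "of_nat d / (fact r * fact (q m)) \<in> (\<int> :: rat set)" if "i + 1 = m \<and> A_block Afirst i"
    proof -
      have "l = r + q m" using that l by auto
      then show ?thesis using d_div[of 0 1 r "q m"] ln by simp
    qed
    show "C (k - 1, l - j) / fact j \<in> \<int>"
      if "k \<in> {2..<l}" "1 \<le> j \<and> j \<le> r \<and> j < l \<and> C (k - 1, l - j) \<noteq> 0" for k j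
      using C_div[of "k - 1" "l - j" j 0] that ln by auto
    show "C (k - 1, l - r - j) / (fact r * fact j) \<in> \<int>"
      if "k \<in> {2..<l}" "1 \<le> j \<and> j \<le> q (i + 1) \<and> r + j < l \<and> C (k - 1, l - r - j) \<noteq> 0" for k j
      using that ln by (intro C_div) auto
  qed
  have last_div: "C (k, n) / of_nat k \<in> \<int>" if "k \<in> {1..n}" for k
  proof -
    let ?c = "nc_coeff (bch_base ^ k) w"
    obtain N where N: "fact n * ?c = of_int N"
      using fact_times_nc_coeff_base_power_Ints[of w k] lenw by (auto elim: Ints_cases)
    have "int k dvd int (d_seq n) * N"
      using that n N lenw p_local_nc_coeff_base_power[of _ k w]
      by (intro dvd_mult_d_seq[of n k N ?c]) auto
    then obtain z where "int (d_seq n) * N = int k * z" by blast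
    from arg_cong[OF this, of "of_int :: int \<Rightarrow> rat"]
    have "of_nat (d_seq n) * (fact n * ?c) = of_nat k * of_int z" by (simp add: N)
    then have "C (k, n) = of_nat k * of_int z" using that by (simp add: Cn assms(4) ac_simps)
    then show ?thesis using that by simp
  qed
  have entries: "C (k, l) \<in> \<int>" if "k \<in> {1..n}" "l \<in> {1..n}" for k l
    using C_div[of k l 0 0] that by simp
  show ?thesis
    by (rule conjI[OF alg conjI[OF series conjI[OF _ conjI]]])
       ((rule ballI allI impI)+, rule steps last_div entries, assumption+)+
qed

end
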